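(* Let $(a_j)_{j\in\mathbb{Z}}$ be an arbitrary sequence of integers with $a_j\geq 2$, and let $\lambda=(\lambda_1,\dots,\lambda_h)$ be a partition with conjugate $\lambda'=(\lambda'_1,\dots,\lambda'_{\lambda_1})$. Then the following identity of polynomials in $t$ holds: $$\det\Big(\zeta^{1-t}\big(a_{1-j},a_{2-j},\dots,a_{(\lambda_i+j-i)-j}\big)\Big)_{1\leq i,j\leq h}=\det\Big(\zeta^t\big(a_{j-1},a_{j-2},\dots,a_{j-(\lambda'_i+j-i)}\big)\Big)_{1\leq i,j\leq\lambda_1}.$$ Here the $(i,j)$ entry on the left has $\lambda_i+j-i$ arguments and the $(i,j)$ entry on the right has $\lambda'_i+j-i$ arguments; an entry is set to be $1$ if its number of arguments is $0$, and $0$ if its number of arguments is negative.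
   Context: A partition is a tuple $\lambda=(\lambda_1,\dots,\lambda_h)$ of integers with $\lambda_1\geq\dots\geq\lambda_h\geq 1$. Its conjugate $\lambda'=(\lambda'_1,\dots,\lambda'_{\lambda_1})$ is given by $\lambda'_j=\#\{i\mid\lambda_i\geq j\}$. For integers $k_1,\dots,k_{r-1}\geq 1$, $k_r\geq 2$, the interpolated multiple zeta value is the polynomial in $t$ $$\zeta^t(k_1,\dots,k_r)=\sum_{0<m_1\leq\dots\leq m_r}\frac{t^{e(m_1,\dots,m_r)}}{m_1^{k_1}\cdots m_r^{k_r}}\in\mathbb{R}[t],\qquad e(m_1,\dots,m_r)=\#\{1\leq i\leq r-1\mid m_i=m_{i+1}\},$$ and $\zeta^{1-t}(k_1,\dots,k_r)$ is obtained from it by substituting $1-t$ for $t$. *)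

theory Defs
  imports
    "HOL-Computational_Algebra.Polynomial"
    "HOL-Analysis.Infinite_Sum"
    "Jordan_Normal_Form.Determinant"
begin

definition is_partition :: "nat list \<Rightarrow> bool" where
  "is_partition p \<longleftrightarrow> sorted_wrt (\<ge>) p \<and> (\<forall>x\<in>set p. x \<ge> 1)"

definition conjugate_partition :: "nat list \<Rightarrow> nat list" where
  "conjugate_partition p =
     (case p of [] \<Rightarrow> []
      | p1 # _ \<Rightarrow> map (\<lambda>j. card {i. i < length p \<and> p ! i \<ge> j}) [1..<Suc p1])"

definition mzv_tuples :: "nat \<Rightarrow> nat list set" where
  "mzv_tuples r = {ms. length ms = r \<and> sorted ms \<and> (\<forall>m\<in>set ms. 0 < m)}"

definition num_equalities :: "nat list \<Rightarrow> nat" where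
  "num_equalities ms = card {i. Suc i < length ms \<and> ms ! i = ms ! Suc i}"

text \<open>
  The interpolated multiple zeta value as a polynomial in \<open>t\<close>. The series over tuples is taken
  coefficientwise: the coefficient of \<open>t ^ e\<close> is the sum over all tuples with exactly \<open>e\<close>
  equalities, and \<open>e\<close> is less than the number of arguments \<open>r\<close> as soon as \<open>r \<ge> 1\<close>. For
  \<open>k\<^sub>1, \<dots>, k\<^sub>r\<^sub>-\<^sub>1 \<ge> 1\<close> and \<open>k\<^sub>r \<ge> 2\<close> these sums of nonnegative terms converge, so the default
  value of \<^const>\<open>infsum\<close> is not used. The value at the empty list is never used.
\<close>
definition interpolated_mzv :: "nat list \<Rightarrow> real poly" where
  "interpolated_mzv ks =
     (\<Sum>e<length ks.
        monom (\<Sum>\<^sub>\<infinity>ms\<in>{ms \<in> mzv_tuples (length ks). num_equalities ms = e}.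
                 1 / (\<Prod>i<length ks. real (ms ! i) ^ (ks ! i))) e)"

definition interpolated_mzv_compl :: "nat list \<Rightarrow> real poly" where
  "interpolated_mzv_compl ks = pcompose (interpolated_mzv ks) [:1, -1:]"

text \<open>
  \<open>zeta_entry z n b\<close> is \<open>z(b 1, \<dots>, b n)\<close>, with the conventions for \<open>n \<le> 0\<close> arguments.
\<close>
definition zeta_entry :: "(nat list \<Rightarrow> real poly) \<Rightarrow> int \<Rightarrow> (int \<Rightarrow> nat) \<Rightarrow> real poly" where
  "zeta_entry z n b =
     (if n < 0 then 0 else if n = 0 then 1 else z (map b [1..n]))"

text \<open>
  Matrices and lists are indexed from \<open>0\<close>, so position \<open>(i, j)\<close> below is the entry
  \<open>(i + 1, j + 1)\<close> in the usual numbering of rows and columns. The shift cancels in the number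
  of arguments \<open>p\<^sub>i + j - i\<close>, but not in the indices of \<open>a\<close>.
\<close>
definition row_matrix :: "(int \<Rightarrow> nat) \<Rightarrow> nat list \<Rightarrow> real poly mat" where
  "row_matrix a p =
     mat (length p) (length p)
       (\<lambda>(i, j). zeta_entry interpolated_mzv_compl (int (p ! i) + int j - int i)
                   (\<lambda>s. a (s - (int j + 1))))"

definition column_matrix :: "(int \<Rightarrow> nat) \<Rightarrow> nat list \<Rightarrow> real poly mat" where
  "column_matrix a p =
     (let q = conjugate_partition p in
      mat (length q) (length q)
       (\<lambda>(i, j). zeta_entry interpolated_mzv (int (q ! i) + int j - int i)
                   (\<lambda>s. a ((int j + 1) - s))))"

end

theory Submission imports Defs begin

text \<open>
  Give an adjacent pair \<open>(m, m')\<close> the weight \<open>f = 1, 1 - t, 0\<close> and the weight \<open>g = 0, t, 1\<close>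
  according to \<open>m < m'\<close>, \<open>m = m'\<close>, \<open>m > m'\<close>; then \<open>f + g = 1\<close>. In a product
  \<open>\<zeta>\<^sup>1\<^sup>-\<^sup>t(a\<^sub>u, \<dots>, a\<^sub>w\<^sub>-\<^sub>1) \<zeta>\<^sup>t(a\<^sub>v\<^sub>-\<^sub>1, \<dots>, a\<^sub>w)\<close> the pairs before the cut carry
  \<open>f\<close>, those after it \<open>g\<close>, and the pair at the cut carries \<open>1 = f + g\<close>. The alternating sum
  over all cuts therefore telescopes to \<open>0\<close>: up to signs, the two families form mutually inverse
  unitriangular matrices. The two determinants are complementary minors of these matrices, because
  the numbers \<open>\<lambda>\<^sub>i - i + 1\<close> and \<open>j - \<lambda>'\<^sub>j\<close> together exhaust \<open>1 - h, \<dots>, \<lambda>\<^sub>1\<close>.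
  The telescoping is carried out for truncated (finite) sums with a real value of \<open>t\<close>.
\<close>

subsection \<open>Complementary minors\<close>

text \<open>Both reversals are multiplications by the reversal matrix \<open>R\<close>. As
  \<open>R * R\<close> is the identity, \<open>det R\<close> enters only through its square, which
  is 1, so its sign is never computed.\<close>

lemma det_reverse_rows_cols:
  "det (mat n n (\<lambda>(i, j). f (n - Suc i) (n - Suc j))) = det (mat n n (\<lambda>(i, j). f i j))"
proof -
  define R :: "'a mat" where "R = mat n n (\<lambda>(i, j). if j = n - Suc i then 1 else 0)"
  let ?F = "mat n n (\<lambda>(i, j). f i j)"
  have R: "R \<in> carrier_mat n n" by (simp add: R_def)
  have left: "R * mat n n g = mat n n (\<lambda>(i, j). g (n - Suc i, j))" for g :: "_ \<Rightarrow> 'a"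
    by (rule eq_matI)
       (auto simp: R_def scalar_prod_def if_distrib[of "\<lambda>x. x * _"] cong: if_cong)
  have right: "mat n n g * R = mat n n (\<lambda>(i, j). g (i, n - Suc j))" for g :: "_ \<Rightarrow> 'a"
  proof (rule eq_matI)
    fix i j assume "i < dim_row (mat n n (\<lambda>(i, j). g (i, n - Suc j)))"
      "j < dim_col (mat n n (\<lambda>(i, j). g (i, n - Suc j)))"
    then have ij: "i < n" "j < n" by auto
    then have "(mat n n g * R) $$ (i, j) =
        (\<Sum>k = 0..<n. g (i, k) * (if j = n - Suc k then 1 else 0))"
      by (auto simp: R_def scalar_prod_def)
    also have "\<dots> = (\<Sum>k = 0..<n. if k = n - Suc j then g (i, k) else 0)"
      using ij by (intro sum.cong) auto
    finally show "(mat n n g * R) $$ (i, j) = mat n n (\<lambda>(i, j). g (i, n - Suc j)) $$ (i, j)"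
      using ij by simp
  qed (simp_all add: R_def)
  have "R * R = 1\<^sub>m n"
    unfolding R_def left[unfolded R_def] by (rule eq_matI) auto
  then have RR: "det R * det R = 1"
    using det_mult[OF R R] by simp
  have "mat n n (\<lambda>(i, j). f (n - Suc i) (n - Suc j)) = R * ?F * R"
    unfolding left right by simp
  then have "det (mat n n (\<lambda>(i, j). f (n - Suc i) (n - Suc j))) = det R * det ?F * det R"
    using det_mult[of "R * ?F" n R] det_mult[OF R, of ?F] R by simp
  also have "\<dots> = (det R * det R) * det ?F" by (simp only: ac_simps)
  finally show ?thesis by (simp add: RR)
qed

text \<open>Every term of the Leibniz expansion meets each row and each column once, so it
  contributes the same product of scalars whatever the permutation.\<close>

lemma det_scale_rows_cols:
  "det (mat n n (\<lambda>(i, j). \<alpha> i * \<beta> j * f i j)) =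
    (\<Prod>i<n. \<alpha> i * \<beta> i) * det (mat n n (\<lambda>(i, j). f i j))"
proof -
  have det: "det (mat n n (\<lambda>(i, j). g i j)) =
      (\<Sum>\<pi> | \<pi> permutes {0..<n}. signof \<pi> * (\<Prod>i = 0..<n. g i (\<pi> i)))" for g :: "nat \<Rightarrow> nat \<Rightarrow> 'a"
    by (subst det_def'[where n = n])
       (auto simp: permutes_in_image[of _ "{0..<n}", simplified] intro!: sum.cong prod.cong)
  have "(\<Prod>i = 0..<n. \<alpha> i * \<beta> (\<pi> i) * f i (\<pi> i)) = (\<Prod>i<n. \<alpha> i * \<beta> i) * (\<Prod>i = 0..<n. f i (\<pi> i))"
    if "\<pi> permutes {0..<n}" for \<pi>
    using prod.permute[OF that, of \<beta>] by (simp add: prod.distrib comp_def lessThan_atLeast0)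
  then show ?thesis
    by (simp add: det sum_distrib_left mult.left_commute)
qed

text \<open>Laplace expansion along the last column, repeated \<open>l\<close> times: each step
  deletes the row of the single 1 and contributes the sign of its position
  \<open>(c s, h + s)\<close>. The rows listed by \<open>r\<close> are those that survive.\<close>

lemma det_unit_columns:
  fixes C :: "nat \<Rightarrow> nat \<Rightarrow> 'a :: comm_ring_1"
  assumes "strict_mono_on {..<h} r" and "\<And>k. k < h \<Longrightarrow> r k < h + l"
    and "strict_mono_on {..<l} c" and "\<And>s. s < l \<Longrightarrow> c s < h + l"
    and "\<And>k s. k < h \<Longrightarrow> s < l \<Longrightarrow> r k \<noteq> c s"
    and "\<And>i s. i < h + l \<Longrightarrow> s < l \<Longrightarrow> C i (h + s) = (if i = c s then 1 else 0)"
  shows "det (mat (h + l) (h + l) (\<lambda>(i, j). C i j)) =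
    (-1) ^ (\<Sum>s<l. c s + h + s) * det (mat h h (\<lambda>(k, j). C (r k) j))"
  using assms
proof (induction l arbitrary: C r)
  case 0
  \<comment> \<open>A strictly increasing map of \<open>{..<h}\<close> into itself is the identity,
    so with no unit columns left nothing is selected.\<close>
  have r: "r k = k" if "k < h" for k
  proof (rule antisym)
    show "k \<le> r k"
      using that
    proof (induction k)
      case (Suc k)
      then have "r k < r (Suc k)"
        using 0(1) by (auto simp: strict_mono_on_def)
      with Suc show ?case by simp
    qed simp
    have "r k + d < h" if "k + d < h" for d
      using that
    proof (induction d arbitrary: k)
      case 0 then show ?case using \<open>\<And>k. k < h \<Longrightarrow> r k < h + 0\<close> by simp
    next
      case (Suc d)
      then have "r k < r (Suc k)"
        using 0(1) by (auto simp: strict_mono_on_def)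
      with Suc.IH[of "Suc k"] Suc.prems show ?case by simp
    qed
    from this[of "h - Suc k"] that show "r k \<le> k" by linarith
  qed
  have "mat h h (\<lambda>(k, j). C (r k) j) = mat h h (\<lambda>(i, j). C i j)"
    by (rule eq_matI) (auto simp: r)
  then show ?case by simp
next
  case (Suc l)
  let ?n = "h + Suc l" and ?m = "h + l"
  let ?A = "mat ?n ?n (\<lambda>(i, j). C i j)"
  \<comment> \<open>The deleted row \<open>z\<close> is the largest of the \<open>c s\<close>, so
    deleting it leaves the other \<open>c s\<close> unchanged. Only the rows in \<open>r\<close>
    beyond \<open>z\<close> are renumbered, which is what \<open>r'\<close> records.\<close>
  define z where "z = c l"
  define C' where "C' i j = C (insert_index z i) j" for i j
  define r' where "r' k = delete_index z (r k)" for k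
  have z: "z < ?n" using Suc.prems(4) by (simp add: z_def)
  have cz: "c s < z" if "s < l" for s
    using Suc.prems(3) that by (auto simp: z_def strict_mono_on_def)
  have rz: "r k \<noteq> z" if "k < h" for k
    using Suc.prems(5)[OF that, of l] by (simp add: z_def)
  have ins: "insert_index z (r' k) = r k" if "k < h" for k
    using rz[OF that] by (auto simp: r'_def insert_index_def delete_index_def)
  have "det ?A = (\<Sum>i<?n. ?A $$ (i, ?m) * cofactor ?A i ?m)"
    by (rule laplace_expansion_column) auto
  also have "\<dots> = (\<Sum>i<?n. if i = z then cofactor ?A i ?m else 0)"
    using Suc.prems(6)[of _ l] by (intro sum.cong) (auto simp: z_def)
  also have "\<dots> = cofactor ?A z ?m" using z by simp
  also have "mat_delete ?A z ?m = mat ?m ?m (\<lambda>(i, j). C' i j)"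
    using z by (intro eq_matI) (auto simp: mat_delete_def C'_def insert_index_def)
  then have "cofactor ?A z ?m = (-1) ^ (z + ?m) * det (mat ?m ?m (\<lambda>(i, j). C' i j))"
    by (simp add: cofactor_def)
  also have "det (mat ?m ?m (\<lambda>(i, j). C' i j)) =
      (-1) ^ (\<Sum>s<l. c s + h + s) * det (mat h h (\<lambda>(k, j). C' (r' k) j))"
  proof (rule Suc.IH)
    show "strict_mono_on {..<h} r'"
    proof (rule strict_mono_onI)
      fix k k' assume "k \<in> {..<h}" "k' \<in> {..<h}" "k < k'"
      moreover from this have "r k < r k'"
        using Suc.prems(1) by (auto simp: strict_mono_on_def)
      ultimately show "r' k < r' k'"
        using rz[of k] rz[of k'] by (auto simp: r'_def delete_index_def)
    qed
    show "r' k < ?m" if "k < h" for k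
      using Suc.prems(2)[OF that] rz[OF that] z by (auto simp: r'_def delete_index_def)
    show "strict_mono_on {..<l} c"
      using Suc.prems(3) by (auto simp: strict_mono_on_def)
    show "c s < ?m" if "s < l" for s
      using cz[OF that] z by simp
    show "r' k \<noteq> c s" if "k < h" "s < l" for k s
      using Suc.prems(5)[of k s] that cz[of s] rz[of k] by (auto simp: r'_def delete_index_def)
    show "C' i (h + s) = (if i = c s then 1 else 0)" if "i < ?m" "s < l" for i s
      using that cz[of s] Suc.prems(6)[of "insert_index z i" s]
      by (auto simp: C'_def insert_index_def)
  qed
  also have "mat h h (\<lambda>(k, j). C' (r' k) j) = mat h h (\<lambda>(k, j). C (r k) j)"
    by (rule eq_matI) (auto simp: C'_def ins)
  finally show ?case
    by (simp add: z_def power_add ac_simps)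
qed

text \<open>With \<open>C = [A\<^sub>J | e\<^sub>c]\<close>, where \<open>J\<close> are the first \<open>h\<close> columns and \<open>e\<^sub>c\<close> the unit columns
  of the rows \<open>c\<close>, the product \<open>B C\<close> is block triangular with blocks \<open>1\<close> and the minor of
  \<open>B\<close>.\<close>

lemma complementary_minor:
  fixes A B :: "nat \<Rightarrow> nat \<Rightarrow> 'a :: idom"
  assumes r: "strict_mono_on {..<h} r" "\<And>k. k < h \<Longrightarrow> r k < h + l"
    and c: "strict_mono_on {..<l} c" "\<And>s. s < l \<Longrightarrow> c s < h + l"
    and rc: "\<And>k s. k < h \<Longrightarrow> s < l \<Longrightarrow> r k \<noteq> c s"
    and B: "\<And>i j. i < j \<Longrightarrow> j < h + l \<Longrightarrow> B i j = 0" "\<And>i. i < h + l \<Longrightarrow> B i i = 1"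
    and BA: "\<And>i j. i < h + l \<Longrightarrow> j < h + l \<Longrightarrow>
      (\<Sum>k<h + l. B i k * A k j) = (if i = j then 1 else 0)"
  shows "(-1) ^ (\<Sum>s<l. c s + h + s) * det (mat h h (\<lambda>(k, j). A (r k) j)) =
    det (mat l l (\<lambda>(k, s). B (h + k) (c s)))"
proof -
  define n where "n = h + l"
  define C where "C i j = (if j < h then A i j else if i = c (j - h) then 1 else 0)" for i j
  let ?B = "mat n n (\<lambda>(i, j). B i j)" and ?C = "mat n n (\<lambda>(i, j). C i j)"
  \<comment> \<open>\<open>B\<close> is lower unitriangular, so multiplying \<open>C\<close> by it
    leaves the determinant unchanged.\<close>
  have detB: "det ?B = 1"
  proof -
    have "det ?B = prod_list (diag_mat ?B)"
      by (rule det_lower_triangular[of n]) (auto simp: B n_def)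
    also have "\<dots> = 1"
      by (auto simp: prod_list_diag_prod B n_def intro!: prod.neutral)
    finally show ?thesis .
  qed
  have entry: "(?B * ?C) $$ (i, j) =
      (if j < h then if i = j then 1 else 0 else B i (c (j - h)))" if "i < n" "j < n" for i j
  proof -
    have "(?B * ?C) $$ (i, j) = (\<Sum>k<n. B i k * C k j)"
      using that by (auto simp: scalar_prod_def atLeast0LessThan)
    also have "\<dots> = (if j < h then if i = j then 1 else 0 else B i (c (j - h)))"
    proof (cases "j < h")
      case True
      then show ?thesis using BA[of i j] that by (simp add: C_def n_def)
    next
      case False
      then have "(\<Sum>k<n. B i k * C k j) = (\<Sum>k<n. if k = c (j - h) then B i k else 0)"
        by (intro sum.cong) (auto simp: C_def)
      also have "\<dots> = B i (c (j - h))"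
        using False that c(2)[of "j - h"] by (simp add: n_def)
      finally show ?thesis using False by simp
    qed
    finally show ?thesis .
  qed
  have "det ?C = det (?B * ?C)"
    using det_mult[of ?B n ?C] detB by simp
  \<comment> \<open>The columns of \<open>C\<close> taken from \<open>A\<close> become the first
    \<open>h\<close> columns of the identity because \<open>B\<close> is inverse to
    \<open>A\<close>; the unit column at \<open>c s\<close> picks out column \<open>c s\<close> of
    \<open>B\<close>.\<close>
  also have "?B * ?C = four_block_mat (1\<^sub>m h) (mat h l (\<lambda>(i, s). B i (c s)))
      (0\<^sub>m l h) (mat l l (\<lambda>(k, s). B (h + k) (c s)))"
    using entry by (intro eq_matI) (auto simp: n_def)
  also have "det \<dots> = det (mat l l (\<lambda>(k, s). B (h + k) (c s)))"
    by (subst det_four_block_mat_lower_left_zero[of _ h _ l]) auto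
  finally have "det ?C = det (mat l l (\<lambda>(k, s). B (h + k) (c s)))" .
  moreover have "det ?C = (-1) ^ (\<Sum>s<l. c s + h + s) * det (mat h h (\<lambda>(k, j). C (r k) j))"
    unfolding n_def by (rule det_unit_columns) (use r c rc in \<open>auto simp: C_def\<close>)
  moreover have "mat h h (\<lambda>(k, j). C (r k) j) = mat h h (\<lambda>(k, j). A (r k) j)"
    by (rule eq_matI) (auto simp: C_def)
  ultimately show ?thesis by simp
qed

subsection \<open>Sums over chains\<close>

lemma sum_lists_append:
  "(\<Sum>zs | set zs \<subseteq> A \<and> length zs = m + n. g zs) =
   (\<Sum>xs | set xs \<subseteq> A \<and> length xs = m. \<Sum>ys | set ys \<subseteq> A \<and> length ys = n. g (xs @ ys))"
  unfolding sum.cartesian_product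
  by (rule sum.reindex_bij_witness[of _ "\<lambda>(xs, ys). xs @ ys" "\<lambda>zs. (take m zs, drop m zs)"])
     (auto dest: in_set_takeD in_set_dropD)

text \<open>The pair weight \<open>f\<close> is left arbitrary so that one definition covers
  ascending and descending tuples. For the empty list both products are empty, so the value is 1, as
  the determinants require.\<close>

definition chain_sum ::
    "('k \<Rightarrow> 'b \<Rightarrow> 'a :: comm_ring_1) \<Rightarrow> ('b \<Rightarrow> 'b \<Rightarrow> 'a) \<Rightarrow> 'b set \<Rightarrow> 'k list \<Rightarrow> 'a" where
  "chain_sum x f A ks = (\<Sum>ms | set ms \<subseteq> A \<and> length ms = length ks.
     (\<Prod>i<length ks - 1. f (ms ! i) (ms ! Suc i)) * (\<Prod>i<length ks. x (ks ! i) (ms ! i)))"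

lemma chain_sum_Nil [simp]: "chain_sum x f A [] = 1"
proof -
  have "{ms. set ms \<subseteq> A \<and> ms = []} = {[]}" by auto
  then show ?thesis by (simp add: chain_sum_def)
qed

text \<open>Reversing the tuples trades reversed arguments for a flipped pair weight. Both factors
  of a cut product can then be read along the same list \<open>ks\<close>.\<close>

lemma chain_sum_rev: "chain_sum x f A (rev ks) = chain_sum x (\<lambda>m m'. f m' m) A ks"
  unfolding chain_sum_def
proof (rule sum.reindex_bij_witness[of _ rev rev], goal_cases)
  case (5 ms)
  let ?n = "length ks"
  have "(\<Prod>i<?n - 1. f (rev ms ! Suc i) (rev ms ! i)) =
      (\<Prod>i<?n - 1. f (ms ! (?n - 1 - Suc i)) (ms ! Suc (?n - 1 - Suc i)))"
    using 5 by (intro prod.cong arg_cong2[of _ _ _ _ f]) (auto simp: rev_nth Suc_diff_Suc)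
  also have "\<dots> = (\<Prod>i<?n - 1. f (ms ! i) (ms ! Suc i))"
    by (rule prod.nat_diff_reindex)
  finally have "(\<Prod>i<?n - 1. f (rev ms ! Suc i) (rev ms ! i)) = (\<Prod>i<?n - 1. f (ms ! i) (ms ! Suc i))" .
  moreover have "(\<Prod>i<?n. x (ks ! i) (rev ms ! i)) =
      (\<Prod>i<?n. x (rev ks ! (?n - Suc i)) (ms ! (?n - Suc i)))"
    using 5 by (intro prod.cong) (auto simp: rev_nth)
  moreover have "\<dots> = (\<Prod>i<?n. x (rev ks ! i) (ms ! i))"
    by (rule prod.nat_diff_reindex)
  ultimately show ?case by simp
qed auto

text \<open>Concatenating the two tuples gives one tuple of full length in which the pair straddling
  the cut, at positions \<open>w - 1\<close> and \<open>w\<close>, has no weight. If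
  \<open>w\<close> is 0 or \<open>length ks\<close>, no pair straddles the cut and all pairs carry
  \<open>g\<close> or \<open>f\<close> respectively.\<close>

lemma chain_sum_take_drop:
  assumes w: "w \<le> length ks"
  shows "chain_sum x f A (take w ks) * chain_sum x g A (drop w ks) =
    (\<Sum>ms | set ms \<subseteq> A \<and> length ms = length ks.
      (\<Prod>i<w - 1. f (ms ! i) (ms ! Suc i)) *
      (\<Prod>i = w..<length ks - 1. g (ms ! i) (ms ! Suc i)) *
      (\<Prod>i<length ks. x (ks ! i) (ms ! i)))"
proof -
  define v where "v = length ks - w"
  have len: "length ks = w + v" using w by (simp add: v_def)
  have shift: "(\<Prod>i = w..<w + n. h i) = (\<Prod>i<n. h (w + i))" for n and h :: "nat \<Rightarrow> 'b"
    by (rule prod.reindex_bij_witness[of _ "\<lambda>i. w + i" "\<lambda>i. i - w"]) auto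
  have split: "(\<Prod>i<w + v. h i) = (\<Prod>i<w. h i) * (\<Prod>i<v. h (w + i))" for h :: "nat \<Rightarrow> 'b"
    using prod.atLeastLessThan_concat[of 0 w "w + v" h] by (simp add: shift lessThan_atLeast0)
  have g: "(\<Prod>i = w..<w + v - 1. g ((xs @ ys) ! i) ((xs @ ys) ! Suc i)) =
      (\<Prod>i<v - 1. g (ys ! i) (ys ! Suc i))" if "length xs = w" for xs ys
  proof (cases v)
    case (Suc n)
    then show ?thesis using that by (simp add: shift nth_append)
  qed (auto intro!: prod.neutral)
  have f: "(\<Prod>i<w - 1. f ((xs @ ys) ! i) ((xs @ ys) ! Suc i)) =
      (\<Prod>i<w - 1. f (xs ! i) (xs ! Suc i))" if "length xs = w" for xs ys
    using that by (intro prod.cong) (auto simp: nth_append)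
  have x: "(\<Prod>i<w + v. x (ks ! i) ((xs @ ys) ! i)) =
      (\<Prod>i<w. x (take w ks ! i) (xs ! i)) * (\<Prod>i<v. x (drop w ks ! i) (ys ! i))"
    if "length xs = w" for xs ys
    using that len by (simp add: split nth_append)
  have "chain_sum x f A (take w ks) * chain_sum x g A (drop w ks) =
    (\<Sum>xs | set xs \<subseteq> A \<and> length xs = w. \<Sum>ys | set ys \<subseteq> A \<and> length ys = v.
      (\<Prod>i<w - 1. f (xs ! i) (xs ! Suc i)) * (\<Prod>i<w. x (take w ks ! i) (xs ! i)) *
      ((\<Prod>i<v - 1. g (ys ! i) (ys ! Suc i)) * (\<Prod>i<v. x (drop w ks ! i) (ys ! i))))"
    using len by (simp add: chain_sum_def sum_product del: nth_take nth_drop)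
  also have "\<dots> =
    (\<Sum>xs | set xs \<subseteq> A \<and> length xs = w. \<Sum>ys | set ys \<subseteq> A \<and> length ys = v.
      (\<Prod>i<w - 1. f ((xs @ ys) ! i) ((xs @ ys) ! Suc i)) *
      (\<Prod>i = w..<w + v - 1. g ((xs @ ys) ! i) ((xs @ ys) ! Suc i)) *
      (\<Prod>i<w + v. x (ks ! i) ((xs @ ys) ! i)))"
  proof (intro sum.cong refl, goal_cases)
    case (1 xs ys)
    then have "length xs = w" by simp
    then show ?case by (simp only: f g x) (simp only: ac_simps)
  qed
  finally show ?thesis
    by (simp only: len sum_lists_append)
qed

text \<open>The sum of the terms up to \<open>w = v\<close> collapses to (-1)^v times the product of
  \<open>f i\<close> for i < v and of \<open>g i\<close> for v \<le> i < n, since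
  \<open>g v = 1 - f v\<close>. At v = n this is cancelled by the one remaining term,
  \<open>w = Suc n\<close>.\<close>

lemma alternating_cut_sum:
  fixes f g :: "nat \<Rightarrow> 'a :: comm_ring_1"
  assumes "\<And>i. f i + g i = 1"
  shows "(\<Sum>w\<le>Suc n. (-1) ^ w * ((\<Prod>i<w - 1. f i) * (\<Prod>i = w..<n. g i))) = 0"
proof -
  have "(\<Sum>w\<le>v. (-1) ^ w * ((\<Prod>i<w - 1. f i) * (\<Prod>i = w..<n. g i))) =
      (-1) ^ v * ((\<Prod>i<v. f i) * (\<Prod>i = v..<n. g i))" if "v \<le> n" for v
    using that
  proof (induction v)
    case (Suc v)
    have g: "g v = 1 - f v" using assms[of v] by (simp add: algebra_simps)
    let ?F = "\<Prod>i<v. f i" and ?G = "\<Prod>i = Suc v..<n. g i"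
    have G: "(\<Prod>i = v..<n. g i) = (1 - f v) * ?G"
      using Suc.prems by (subst prod.atLeast_Suc_lessThan) (auto simp: g)
    have "(\<Sum>w\<le>Suc v. (-1) ^ w * ((\<Prod>i<w - 1. f i) * (\<Prod>i = w..<n. g i))) =
        (-1) ^ v * (?F * ((1 - f v) * ?G)) + (-1) ^ Suc v * (?F * ?G)"
      using Suc by (simp add: G)
    also have "\<dots> = (-1) ^ Suc v * ((?F * f v) * ?G)"
      by (simp add: algebra_simps)
    finally show ?case by simp
  qed simp
  from this[of n] show ?thesis by simp
qed

text \<open>After exchanging the sums, the cuts of each fixed tuple already cancel; here
  \<open>n\<close> is the number of adjacent pairs.\<close>

lemma chain_sum_orthogonality:
  assumes fg: "\<And>m m'. f m m' + g m m' = 1" and "ks \<noteq> []"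
  shows "(\<Sum>w\<le>length ks. (-1) ^ w * (chain_sum x f A (take w ks) * chain_sum x g A (drop w ks))) = 0"
proof -
  obtain n where n: "length ks = Suc n" using \<open>ks \<noteq> []\<close> by (cases ks) auto
  let ?c = "\<lambda>w ms. (\<Prod>i<w - 1. f (ms ! i) (ms ! Suc i)) * (\<Prod>i = w..<n. g (ms ! i) (ms ! Suc i))"
  let ?L = "{ms. set ms \<subseteq> A \<and> length ms = length ks}"
  have "(\<Sum>w\<le>length ks. (-1) ^ w * (chain_sum x f A (take w ks) * chain_sum x g A (drop w ks))) =
      (\<Sum>w\<le>Suc n. \<Sum>ms\<in>?L. (-1) ^ w * ?c w ms * (\<Prod>i<length ks. x (ks ! i) (ms ! i)))"
    using n by (intro sum.cong) (simp_all add: chain_sum_take_drop sum_distrib_left mult.assoc)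
  also have "\<dots> = (\<Sum>ms\<in>?L. (\<Sum>w\<le>Suc n. (-1) ^ w * ?c w ms) * (\<Prod>i<length ks. x (ks ! i) (ms ! i)))"
    by (subst sum.swap) (simp only: sum_distrib_right)
  also have "\<dots> = 0"
    using alternating_cut_sum[OF fg] by (intro sum.neutral ballI) (simp only: mult_zero_left)
  finally show ?thesis .
qed

subsection \<open>Truncated interpolated multiple zeta values\<close>

text \<open>The pair weight of the interpolated sums. The required complement is
  \<open>weak_step (1 - t) m m' + weak_step t m' m = 1\<close>, with the arguments of the second
  term swapped.\<close>

definition weak_step :: "real \<Rightarrow> nat \<Rightarrow> nat \<Rightarrow> real" where
  "weak_step t m m' = (if m < m' then 1 else if m = m' then t else 0)"

text \<open>A tuple that is not sorted has an adjacent descent, whose weight is 0. Sums over all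
  tuples thus reduce to the weakly increasing ones.\<close>

lemma prod_weak_step:
  "(\<Prod>i<length ms - 1. weak_step t (ms ! i) (ms ! Suc i)) =
    (if sorted ms then t ^ num_equalities ms else 0)"
proof (cases "sorted ms")
  case True
  then have le: "ms ! i \<le> ms ! Suc i" if "Suc i < length ms" for i
    using that by (simp add: sorted_iff_nth_Suc)
  have "(\<Prod>i<length ms - 1. weak_step t (ms ! i) (ms ! Suc i)) =
      (\<Prod>i<length ms - 1. if ms ! i = ms ! Suc i then t else 1)"
  proof (intro prod.cong refl)
    fix i assume "i \<in> {..<length ms - 1}"
    then have "ms ! i \<le> ms ! Suc i" by (intro le) auto
    then show "weak_step t (ms ! i) (ms ! Suc i) = (if ms ! i = ms ! Suc i then t else 1)"
      by (auto simp: weak_step_def)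
  qed
  also have "\<dots> = t ^ card {i \<in> {..<length ms - 1}. ms ! i = ms ! Suc i}"
    by (subst prod.inter_filter[symmetric]) simp_all
  also have "{i \<in> {..<length ms - 1}. ms ! i = ms ! Suc i} =
      {i. Suc i < length ms \<and> ms ! i = ms ! Suc i}" by auto
  finally show ?thesis using True by (simp add: num_equalities_def)
next
  case False
  then obtain i where "Suc i < length ms" "ms ! Suc i < ms ! i"
    by (auto simp: sorted_iff_nth_Suc not_le)
  then have "(\<Prod>i<length ms - 1. weak_step t (ms ! i) (ms ! Suc i)) = 0"
    by (intro prod_zero bexI[of _ i]) (auto simp: weak_step_def)
  with False show ?thesis by simp
qed

lemma num_equalities_less:
  assumes "ms \<noteq> []"
  shows "num_equalities ms < length ms"
proof -
  have "num_equalities ms \<le> card {..<length ms - 1}"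
    unfolding num_equalities_def by (rule card_mono) auto
  with assms show ?thesis by (cases ms) auto
qed

text \<open>Turns an unordered sum into a limit along an increasing exhaustion: every finite subset
  of \<open>T\<close> is contained in \<open>X M\<close> for all large \<open>M\<close>.\<close>

lemma has_sum_exhaustion:
  assumes "(g has_sum S) T" and "\<And>M :: nat. finite (X M)" "\<And>M. X M \<subseteq> T" "mono X" "T \<subseteq> (\<Union>M. X M)"
  shows "(\<lambda>M. sum g (X M)) \<longlonglongrightarrow> S"
proof -
  have "filterlim X (finite_subsets_at_top T) sequentially"
    unfolding filterlim_finite_subsets_at_top
  proof (intro allI impI)
    fix Y assume Y: "finite Y \<and> Y \<subseteq> T"
    then have "\<forall>y\<in>Y. \<exists>M. y \<in> X M" using assms(5) by blast
    then obtain k where k: "\<And>y. y \<in> Y \<Longrightarrow> y \<in> X (k y)" by metis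
    have "Y \<subseteq> X M" if "Max (insert 0 (k ` Y)) \<le> M" for M
    proof
      fix y assume "y \<in> Y"
      with Y that have "k y \<le> M" by simp
      then show "y \<in> X M" using k[OF \<open>y \<in> Y\<close>] monoD[OF \<open>mono X\<close>] by blast
    qed
    then show "\<forall>\<^sub>F M in sequentially. finite (X M) \<and> Y \<subseteq> X M \<and> X M \<subseteq> T"
      using assms(2,3) unfolding eventually_sequentially by blast
  qed
  then show ?thesis
    using assms(1) unfolding has_sum_def by (rule filterlim_compose[rotated])
qed

section \<open>Convergence by comparison with inverse squares\<close>

lemma sum_lists_inverse_squares:
  "(\<Sum>ms | set ms \<subseteq> A \<and> length ms = r. \<Prod>i<r. 1 / real (ms ! i) ^ 2) = (\<Sum>m\<in>A. 1 / real m ^ 2) ^ r"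
proof (induction r)
  case 0
  have "{ms. set ms \<subseteq> A \<and> ms = []} = {[]}" by auto
  then show ?case by simp
next
  case (Suc r)
  have "(\<Sum>ms | set ms \<subseteq> A \<and> length ms = Suc r. \<Prod>i<Suc r. 1 / real (ms ! i) ^ 2) =
      (\<Sum>(m, ms) \<in> A \<times> {ms. set ms \<subseteq> A \<and> length ms = r}. 1 / real m ^ 2 * (\<Prod>i<r. 1 / real (ms ! i) ^ 2))"
    by (rule sum.reindex_bij_witness[of _ "\<lambda>(m, ms). m # ms" "\<lambda>ms. (hd ms, tl ms)"])
       (auto simp: length_Suc_conv prod.lessThan_Suc_shift simp del: prod.lessThan_Suc)
  also have "\<dots> = (\<Sum>m\<in>A. 1 / real m ^ 2) ^ Suc r"
    by (simp only: sum.cartesian_product[symmetric] sum_product[symmetric] Suc power_Suc)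
  finally show ?case .
qed

text \<open>Telescoping with 1/n^2 \<le> 1/(n-1) - 1/n for n \<ge> 2; a finite set of positive
  integers lies in some initial segment.\<close>

lemma sum_inverse_squares_le:
  assumes "finite A" "0 \<notin> A"
  shows "(\<Sum>m\<in>A. 1 / real m ^ 2) \<le> 2"
proof -
  \<comment> \<open>also for \<open>n = 0\<close>, where \<open>1 / real n = 0\<close>\<close>
  have "(\<Sum>m = 1..n. 1 / real m ^ 2) \<le> 2 - 1 / real n" for n
  proof (induction n)
    case (Suc n)
    have "1 / real (Suc n) ^ 2 \<le> 1 / real n - 1 / real (Suc n)" if "0 < n"
    proof -
      have "1 / real (Suc n) ^ 2 \<le> 1 / (real n * real (Suc n))"
        using that by (intro divide_left_mono) (auto simp: power2_eq_square)
      also have "\<dots> = 1 / real n - 1 / real (Suc n)"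
        using that by (simp add: field_simps)
      finally show ?thesis .
    qed
    with Suc show ?case by (cases "n = 0") auto
  qed simp
  from this[of "Max (insert 0 A)"] have "(\<Sum>m = 1..Max (insert 0 A). 1 / real m ^ 2) \<le> 2"
    by (rule order.trans) simp
  moreover have "(\<Sum>m\<in>A. 1 / real m ^ 2) \<le> (\<Sum>m = 1..Max (insert 0 A). 1 / real m ^ 2)"
    using assms by (intro sum_mono2) (auto simp: Suc_le_eq intro!: gr0I)
  ultimately show ?thesis by simp
qed

text \<open>As all exponents are at least 2, each term is at most a product of inverse squares.
  Dropping the order condition makes the bounding sum factor, so every finite partial sum is at most
  \<open>2 ^ length ks\<close>.\<close>

lemma summable_on_mzv_tuples:
  assumes "\<forall>k\<in>set ks. k \<ge> 2"
  shows "(\<lambda>ms. 1 / (\<Prod>i<length ks. real (ms ! i) ^ (ks ! i))) summable_on mzv_tuples (length ks)"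
proof (rule nonneg_bdd_above_summable_on)
  let ?r = "length ks" and ?g = "\<lambda>ms. 1 / (\<Prod>i<length ks. real (ms ! i) ^ (ks ! i))"
  show "0 \<le> ?g ms" for ms by (simp add: prod_nonneg)
  have "sum ?g F \<le> 2 ^ ?r" if F: "F \<subseteq> mzv_tuples ?r" "finite F" for F
  proof -
    define A where "A = (\<Union>ms\<in>F. set ms)"
    have A: "finite A" using F by (auto simp: A_def)
    have "?g ms \<le> (\<Prod>i<?r. 1 / real (ms ! i) ^ 2)" if "ms \<in> F" for ms
    proof -
      have "?g ms = (\<Prod>i<?r. 1 / real (ms ! i) ^ (ks ! i))" by (simp add: prod_dividef)
      also have "\<dots> \<le> (\<Prod>i<?r. 1 / real (ms ! i) ^ 2)"
      proof (intro prod_mono conjI)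
        fix i assume "i \<in> {..<?r}"
        then have "0 < ms ! i" "2 \<le> ks ! i"
          using that F assms by (auto simp: mzv_tuples_def)
        then show "1 / real (ms ! i) ^ (ks ! i) \<le> 1 / real (ms ! i) ^ 2"
          by (intro divide_left_mono power_increasing) auto
      qed simp
      finally show ?thesis .
    qed
    then have "sum ?g F \<le> (\<Sum>ms\<in>F. \<Prod>i<?r. 1 / real (ms ! i) ^ 2)" by (rule sum_mono)
    also have "\<dots> \<le> (\<Sum>ms | set ms \<subseteq> A \<and> length ms = ?r. \<Prod>i<?r. 1 / real (ms ! i) ^ 2)"
      using F A by (intro sum_mono2 finite_lists_length_eq)
        (auto simp: A_def mzv_tuples_def intro!: prod_nonneg)
    also have "\<dots> = (\<Sum>m\<in>A. 1 / real m ^ 2) ^ ?r" by (rule sum_lists_inverse_squares)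
    also have "\<dots> \<le> 2 ^ ?r"
      using A F by (intro power_mono sum_inverse_squares_le sum_nonneg)
        (auto simp: A_def mzv_tuples_def)
    finally show ?thesis .
  qed
  then show "bdd_above (sum ?g ` {F. F \<subseteq> mzv_tuples ?r \<and> finite F})"
    by (intro bdd_aboveI[of _ "2 ^ ?r"]) auto
qed

abbreviation truncated_mzv :: "real \<Rightarrow> nat \<Rightarrow> nat list \<Rightarrow> real" where
  "truncated_mzv t M \<equiv> chain_sum (\<lambda>k m. 1 / real m ^ k) (weak_step t) {1..M}"

text \<open>Grouping the finite sum by the number of equalities gives a polynomial in
  \<open>t\<close> whose coefficients converge separately to those of
  \<open>interpolated_mzv ks\<close>.\<close>

lemma truncated_mzv_tendsto:
  assumes "ks \<noteq> []" and ks: "\<forall>k\<in>set ks. k \<ge> 2"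
  shows "(\<lambda>M. truncated_mzv t M ks) \<longlonglongrightarrow> poly (interpolated_mzv ks) t"
proof -
  let ?r = "length ks" and ?g = "\<lambda>ms. 1 / (\<Prod>i<length ks. real (ms ! i) ^ (ks ! i))"
  let ?T = "\<lambda>e. {ms \<in> mzv_tuples ?r. num_equalities ms = e}"
  let ?X = "\<lambda>M. {ms \<in> mzv_tuples ?r. set ms \<subseteq> {1..M}}"
  have fin: "finite (?X M)" for M
    by (rule finite_subset[OF _ finite_lists_length_eq[of "{1..M}" ?r]])
       (auto simp: mzv_tuples_def)
  have "truncated_mzv t M ks = (\<Sum>e<?r. t ^ e * sum ?g {ms \<in> ?X M. num_equalities ms = e})" for M
  proof -
    have "truncated_mzv t M ks = (\<Sum>ms | set ms \<subseteq> {1..M} \<and> length ms = ?r.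
        (if sorted ms then t ^ num_equalities ms else 0) * ?g ms)"
      unfolding chain_sum_def
      by (intro sum.cong refl) (auto simp: prod_weak_step[symmetric] prod_dividef)
    also have "\<dots> = (\<Sum>ms\<in>?X M. t ^ num_equalities ms * ?g ms)"
    proof (rule sum.mono_neutral_cong_right)
      show "finite {ms. set ms \<subseteq> {1..M} \<and> length ms = ?r}" by (rule finite_lists_length_eq) simp
    qed (auto simp: mzv_tuples_def subset_iff Suc_le_eq)
    also have "\<dots> = (\<Sum>e<?r. \<Sum>ms | ms \<in> ?X M \<and> num_equalities ms = e. t ^ num_equalities ms * ?g ms)"
      using fin \<open>ks \<noteq> []\<close>
    proof (intro sum.group[symmetric])
      show "num_equalities ` ?X M \<subseteq> {..<?r}"
      proof
        fix e assume "e \<in> num_equalities ` ?X M"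
        then obtain ms where "e = num_equalities ms" "length ms = ?r" by (auto simp: mzv_tuples_def)
        moreover from this \<open>ks \<noteq> []\<close> have "ms \<noteq> []" by auto
        ultimately show "e \<in> {..<?r}" using num_equalities_less[of ms] by simp
      qed
    qed auto
    also have "\<dots> = (\<Sum>e<?r. t ^ e * sum ?g {ms \<in> ?X M. num_equalities ms = e})"
      by (simp add: sum_distrib_left)
    finally show ?thesis .
  qed
  moreover have "(\<lambda>M. sum ?g {ms \<in> ?X M. num_equalities ms = e}) \<longlonglongrightarrow> infsum ?g (?T e)" for e
  proof (rule has_sum_exhaustion)
    show "(?g has_sum infsum ?g (?T e)) (?T e)"
      by (intro has_sum_infsum summable_on_subset_banach[OF summable_on_mzv_tuples[OF ks]]) auto
    show "finite {ms \<in> ?X M. num_equalities ms = e}" for M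
      by (rule finite_subset[OF _ fin[of M]]) auto
    show "?T e \<subseteq> (\<Union>M. {ms \<in> ?X M. num_equalities ms = e})"
    proof
      fix ms assume "ms \<in> ?T e"
      \<comment> \<open>The entries of a tuple are bounded by their sum, so
        \<open>sum_list ms\<close> serves as a truncation level that contains
        \<open>ms\<close>.\<close>
      moreover have "m \<le> sum_list ms" if "m \<in> set ms" for m using that by (rule member_le_sum_list) simp
      ultimately have "ms \<in> {ms \<in> ?X (sum_list ms). num_equalities ms = e}"
        by (auto simp: mzv_tuples_def Suc_le_eq)
      then show "ms \<in> (\<Union>M. {ms \<in> ?X M. num_equalities ms = e})" by blast
    qed
    show "mono (\<lambda>M. {ms \<in> ?X M. num_equalities ms = e})"
      by (rule monoI) (auto simp: subset_iff)
  qed auto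
  moreover have "poly (interpolated_mzv ks) t = (\<Sum>e<?r. t ^ e * infsum ?g (?T e))"
    by (simp add: interpolated_mzv_def poly_sum poly_monom mult.commute)
  ultimately show ?thesis
    by (simp only:) (intro tendsto_sum tendsto_mult tendsto_const)
qed

subsection \<open>The duality of determinants\<close>

text \<open>In the paper's notation, \<open>row_entry a u w\<close> is
  \<open>\<zeta>\<^sup>1\<^sup>-\<^sup>t(a\<^sub>u, \<dots>, a\<^sub>w\<^sub>-\<^sub>1)\<close> and \<open>column_entry a u w\<close> is
  \<open>\<zeta>\<^sup>t(a\<^sub>w\<^sub>-\<^sub>1, \<dots>, a\<^sub>u)\<close>.\<close>

definition row_entry :: "(int \<Rightarrow> nat) \<Rightarrow> int \<Rightarrow> int \<Rightarrow> real poly" where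
  "row_entry a u w = zeta_entry interpolated_mzv_compl (w - u) (\<lambda>s. a (u - 1 + s))"

definition column_entry :: "(int \<Rightarrow> nat) \<Rightarrow> int \<Rightarrow> int \<Rightarrow> real poly" where
  "column_entry a u w = zeta_entry interpolated_mzv (w - u) (\<lambda>s. a (w - s))"

text \<open>The cut identity holds for every truncation and every real \<open>t\<close>, hence in
  the limit; a real polynomial that vanishes at all real points is zero.\<close>

lemma row_column_orthogonality:
  assumes a: "\<And>j. a j \<ge> 2" and "0 < r"
  shows "(\<Sum>k\<le>r. (-1) ^ k * (row_entry a u (u + int k) * column_entry a (u + int k) (u + int r))) = 0"
proof -
  define ks where "ks = map (\<lambda>i. a (u + int i)) [0..<r]"
  have ks: "\<forall>k\<in>set (take w ks). k \<ge> 2" "\<forall>k\<in>set (rev (drop w ks)). k \<ge> 2" for w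
    using a by (auto simp: ks_def take_map drop_map)
  \<comment> \<open>The empty list is split off because \<open>interpolated_mzv []\<close> is an
    empty sum, hence 0, while an entry without arguments is 1.\<close>
  have row: "row_entry a u (u + int k) = (if k = 0 then 1 else interpolated_mzv_compl (take k ks))"
    if "k \<le> r" for k
  proof -
    have "map (\<lambda>s. a (u - 1 + s)) [1..int k] = take k ks"
      using that by (intro nth_equalityI) (auto simp: ks_def)
    then show ?thesis by (simp add: row_entry_def zeta_entry_def)
  qed
  have col: "column_entry a (u + int k) (u + int r) =
      (if k = r then 1 else interpolated_mzv (rev (drop k ks)))" if "k \<le> r" for k
  proof -
    have "map (\<lambda>s. a (u + int r - s)) [1..int r - int k] = rev (drop k ks)"
      using that by (intro nth_equalityI)
        (auto simp: ks_def rev_nth intro!: arg_cong[of _ _ a])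
    then show ?thesis using that by (simp add: column_entry_def zeta_entry_def)
  qed
  let ?P = "\<Sum>k\<le>r. (-1) ^ k * (row_entry a u (u + int k) * column_entry a (u + int k) (u + int r))"
  have "poly ?P t = 0" for t
  proof -
    let ?g = "\<lambda>m m'. weak_step t m' m"
    have "(\<lambda>M. truncated_mzv (1 - t) M (take k ks)) \<longlonglongrightarrow> poly (row_entry a u (u + int k)) t"
      if "k \<le> r" for k
    proof (cases "k = 0")
      case False
      then have "take k ks \<noteq> []" using \<open>0 < r\<close> by (simp add: ks_def)
      from truncated_mzv_tendsto[OF this ks(1)] show ?thesis
        using False that by (simp add: row interpolated_mzv_compl_def poly_pcompose)
    qed (use row[of 0] in simp)
    moreover have "(\<lambda>M. truncated_mzv t M (rev (drop k ks))) \<longlonglongrightarrow>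
        poly (column_entry a (u + int k) (u + int r)) t" if "k \<le> r" for k
    proof (cases "k = r")
      case False
      then have "rev (drop k ks) \<noteq> []" using that by (simp add: ks_def)
      from truncated_mzv_tendsto[OF this ks(2)] show ?thesis
        using False that by (simp add: col)
    qed (use col[of r] in \<open>simp add: ks_def\<close>)
    ultimately have "(\<lambda>M. \<Sum>k\<le>r. (-1) ^ k *
        (truncated_mzv (1 - t) M (take k ks) * truncated_mzv t M (rev (drop k ks)))) \<longlonglongrightarrow> poly ?P t"
      by (simp only: poly_sum poly_mult poly_power poly_minus poly_1)
         (intro tendsto_sum tendsto_mult tendsto_const; simp)
    moreover have "(\<Sum>k\<le>r. (-1) ^ k *
        (truncated_mzv (1 - t) M (take k ks) * truncated_mzv t M (rev (drop k ks)))) = 0" for M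
      using chain_sum_orthogonality[of "weak_step (1 - t)" ?g ks "\<lambda>k m. 1 / real m ^ k" "{1..M}"]
        \<open>0 < r\<close>
      by (simp add: chain_sum_rev weak_step_def ks_def)
    ultimately show ?thesis by (simp add: LIMSEQ_const_iff)
  qed
  then show ?thesis by (subst poly_eq_poly_eq_iff[symmetric]) auto
qed

section \<open>Conjugate partitions\<close>

lemma length_conjugate_partition: "length (conjugate_partition p) = (if p = [] then 0 else hd p)"
  by (auto simp: conjugate_partition_def split: list.split)

text \<open>Both sides say that the cell in row \<open>i\<close> and column \<open>s\<close>,
  counted from 0, lies in the diagram. As the parts decrease, the rows reaching column
  \<open>s\<close> form an initial segment, of length
  \<open>conjugate_partition p ! s\<close>.\<close>

lemma less_conjugate_partition_iff:
  assumes p: "is_partition p" and s: "s < length (conjugate_partition p)"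
    and i: "i < length p"
  shows "i < conjugate_partition p ! s \<longleftrightarrow> s < p ! i"
proof -
  let ?S = "{i. i < length p \<and> p ! i \<ge> Suc s}"
  have q: "conjugate_partition p ! s = card ?S"
    using s by (cases p) (auto simp: conjugate_partition_def simp del: upt_Suc)
  have anti: "p ! k \<le> p ! j" if "j \<le> k" "k < length p" for j k
    using p that sorted_wrt_nth_less[of "(\<ge>)" p j k]
    by (cases "j = k") (auto simp: is_partition_def)
  show ?thesis
  proof (cases "s < p ! i")
    case True
    then have "{..i} \<subseteq> ?S" using i anti by (auto simp: Suc_le_eq intro: less_le_trans)
    then have "card {..i} \<le> card ?S" by (intro card_mono) auto
    with True q show ?thesis by simp
  next
    case False
    have "?S \<subseteq> {..<i}"
    proof
      fix k assume "k \<in> ?S"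
      then show "k \<in> {..<i}" using False anti[of i k] by (cases "i \<le> k") auto
    qed
    then have "card ?S \<le> card {..<i}" by (intro card_mono) auto
    with False q show ?thesis by simp
  qed
qed

theorem theorem1p2:
  fixes a :: "int \<Rightarrow> nat" and p :: "nat list"
  assumes "\<And>j. a j \<ge> 2"
    and "is_partition p"
  shows "det (row_matrix a p) = det (column_matrix a p)"
proof -
  define h where "h = length p"
  define q where "q = conjugate_partition p"
  define l where "l = length q"
  \<comment> \<open>The integer \<open>w\<close> with \<open>1 - h \<le> w \<le> l\<close> has row index \<open>w + h - 1\<close>.\<close>
  define \<iota> where "\<iota> k = int k - int h + 1" for k :: nat
  \<comment> \<open>Both matrices are lower unitriangular; the sign in \<open>B\<close> turns the
    alternating cut sum into an entry of the product of \<open>B\<close> and \<open>A\<close>. The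
    indices \<open>r k\<close> and \<open>c s\<close> stand for the integers \<lambda>_i - i + 1
    with i = h - k and j - \<lambda>'_j with j = s + 1.\<close>
  define A where "A w u = row_entry a (\<iota> u) (\<iota> w)" for u w
  define B where "B v w = (-1) ^ (v + w) * column_entry a (\<iota> w) (\<iota> v)" for v w
  define r where "r k = p ! (h - Suc k) + k" for k
  define c where "c s = h + s - q ! s" for s
  have pq: "i < q ! s \<longleftrightarrow> s < p ! i" if "s < l" "i < h" for i s
    using less_conjugate_partition_iff[OF assms(2), of s i] that by (simp add: q_def l_def h_def)
  have anti: "p ! k \<le> p ! j" if "j \<le> k" "k < h" for j k
    using assms(2) that sorted_wrt_nth_less[of "(\<ge>)" p j k]
    by (cases "j = k") (auto simp: is_partition_def h_def)
  have p_le: "p ! i \<le> l" if "i < h" for i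
    using that anti[of 0 i]
    by (auto simp: l_def q_def h_def length_conjugate_partition hd_conv_nth)
  have q_le: "q ! s \<le> h" if "s < l" for s
  proof -
    have "q ! s = card {i. i < length p \<and> p ! i \<ge> Suc s}"
      using that by (cases p) (auto simp: l_def q_def conjugate_partition_def simp del: upt_Suc)
    also have "\<dots> \<le> card {..<h}" by (intro card_mono) (auto simp: h_def)
    finally show ?thesis by simp
  qed
  \<comment> \<open>If \<open>q ! s < q ! s'\<close>, then row \<open>q ! s\<close> reaches column
    \<open>s'\<close>, hence also column \<open>s\<close>, which would give
    \<open>q ! s < q ! s\<close>.\<close>
  have q_anti: "q ! s' \<le> q ! s" if "s \<le> s'" "s' < l" for s s'
  proof (rule ccontr)
    assume "\<not> q ! s' \<le> q ! s"
    moreover from this have "q ! s < h" using q_le[of s'] that by simp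
    ultimately show False using pq[of s' "q ! s"] pq[of s "q ! s"] that by simp
  qed
  have minor: "(-1) ^ (\<Sum>s<l. c s + h + s) * det (mat h h (\<lambda>(k, j). A (r k) j)) =
      det (mat l l (\<lambda>(k, s). B (h + k) (c s)))"
  proof (rule complementary_minor)
    show "strict_mono_on {..<h} r"
    proof (rule strict_mono_onI)
      fix k k' assume "k \<in> {..<h}" "k' \<in> {..<h}" "k < k'"
      then show "r k < r k'" using anti[of "h - Suc k'" "h - Suc k"] by (simp add: r_def diff_le_mono2)
    qed
    show "r k < h + l" if "k < h" for k
      using p_le[of "h - Suc k"] that by (simp add: r_def)
    show "strict_mono_on {..<l} c"
    proof (rule strict_mono_onI)
      fix s s' assume "s \<in> {..<l}" "s' \<in> {..<l}" "s < s'"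
      then show "c s < c s'" using q_anti[of s s'] q_le[of s] by (simp add: c_def)
    qed
    show "c s < h + l" if "s < l" for s
      using that by (simp add: c_def)
    \<comment> \<open>With \<open>i = h - Suc k\<close>, equality would mean
      \<open>p ! i + q ! s = i + s + 1\<close>. By \<open>pq\<close> the left side is at least
      \<open>i + s + 2\<close> if cell \<open>(i, s)\<close> lies in the diagram, and at most
      \<open>i + s\<close> otherwise.\<close>
    show "r k \<noteq> c s" if "k < h" "s < l" for k s
      using pq[of s "h - Suc k"] q_le[of s] that by (auto simp: r_def c_def)
    show "B i j = 0" if "i < j" for i j
      using that by (simp add: B_def column_entry_def zeta_entry_def \<iota>_def)
    show "B i i = 1" for i
      by (simp add: B_def column_entry_def zeta_entry_def)
    show "(\<Sum>k<h + l. B i k * A k j) = (if i = j then 1 else 0)" if "i < h + l" "j < h + l" for i j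
    proof -
      \<comment> \<open>Outside this range one of the two factors has a negative number of arguments
        and is 0.\<close>
      have zero: "B i k * A k j = 0" if "k \<notin> {j..i}" for k
        using that
        by (auto simp: A_def B_def row_entry_def column_entry_def zeta_entry_def \<iota>_def not_le)
      have "(\<Sum>k<h + l. B i k * A k j) = (\<Sum>k\<in>{j..i}. B i k * A k j)"
        using that zero by (intro sum.mono_neutral_right) auto
      also have "\<dots> = (if i = j then 1 else 0)"
      proof (cases "j < i")
        case False
        then show ?thesis
          by (auto simp: A_def B_def row_entry_def column_entry_def zeta_entry_def not_less le_less)
      next
        case True
        define m where "m = i - j"
        have i: "i = j + m" "0 < m" using True by (simp_all add: m_def)
        have "(\<Sum>k\<in>{j..i}. B i k * A k j) = (\<Sum>k\<le>m. B i (j + k) * A (j + k) j)"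
          by (rule sum.reindex_bij_witness[of _ "\<lambda>k. j + k" "\<lambda>k. k - j"]) (auto simp: i)
        also have "\<dots> = (-1) ^ m * (\<Sum>k\<le>m. (-1) ^ k *
            (row_entry a (\<iota> j) (\<iota> j + int k) * column_entry a (\<iota> j + int k) (\<iota> j + int m)))"
          unfolding sum_distrib_left
        proof (rule sum.cong)
          fix k
          have "(-1) ^ (i + (j + k)) = ((-1) ^ m * (-1) ^ k :: real poly)"
            by (auto simp: i minus_one_power_iff)
          moreover have "\<iota> (j + k) = \<iota> j + int k" "\<iota> i = \<iota> j + int m"
            by (simp_all add: \<iota>_def i)
          ultimately show "B i (j + k) * A (j + k) j = (-1) ^ m * ((-1) ^ k *
              (row_entry a (\<iota> j) (\<iota> j + int k) * column_entry a (\<iota> j + int k) (\<iota> j + int m)))"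
            by (simp add: A_def B_def ac_simps)
        qed simp
        also have "\<dots> = 0"
          using row_column_orthogonality[OF assms(1) i(2)] by simp
        finally show ?thesis using True by simp
      qed
      finally show ?thesis .
    qed
  qed
  \<comment> \<open>rows and columns are reversed, since \<open>\<lambda>\<^sub>i - i\<close> and \<open>-j\<close> decrease\<close>
  have row: "det (row_matrix a p) = det (mat h h (\<lambda>(k, j). A (r k) j))"
  proof -
    have "row_matrix a p = mat h h (\<lambda>(i, j). A (r (h - Suc i)) (h - Suc j))"
      by (rule eq_matI)
         (auto simp: row_matrix_def h_def A_def r_def row_entry_def \<iota>_def algebra_simps)
    then show ?thesis
      by (simp add: det_reverse_rows_cols[of h "\<lambda>i j. A (r i) j"])
  qed
  have col: "det (mat l l (\<lambda>(k, s). B (h + k) (c s))) =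
      (-1) ^ (\<Sum>s<l. c s + h + s) * det (column_matrix a p)"
  proof -
    define D where "D = mat l l (\<lambda>(s, k). column_entry a (\<iota> (c s)) (\<iota> (h + k)))"
    have D: "column_matrix a p = D"
    proof (rule eq_matI)
      fix s k assume "s < dim_row D" "k < dim_col D"
      then have s: "s < l" and k: "k < l" by (auto simp: D_def)
      have n: "int (q ! s) + int k - int s = \<iota> (h + k) - \<iota> (c s)"
        and w: "int k + 1 = \<iota> (h + k)"
        using q_le[OF s] by (simp_all add: \<iota>_def c_def)
      have "column_matrix a p $$ (s, k) = zeta_entry interpolated_mzv
          (int (q ! s) + int k - int s) (\<lambda>x. a ((int k + 1) - x))"
        using s k by (simp add: column_matrix_def Let_def l_def q_def[symmetric])
      then show "column_matrix a p $$ (s, k) = D $$ (s, k)"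
        using s k unfolding n w by (simp add: D_def column_entry_def)
    qed (simp_all add: column_matrix_def Let_def D_def l_def q_def)
    \<comment> \<open>The minor of \<open>B\<close> is the transpose of \<open>D\<close> up to the
      sign (-1)^(c s + h + k). This splits into a row factor and a column factor, whose total is
      exactly the sign in \<open>minor\<close>.\<close>
    have "mat l l (\<lambda>(k, s). B (h + k) (c s)) = transpose_mat (mat l l
        (\<lambda>(s, k). (-1) ^ c s * (-1) ^ (h + k) * column_entry a (\<iota> (c s)) (\<iota> (h + k))))"
      by (rule eq_matI) (auto simp: B_def power_add)
    then have "det (mat l l (\<lambda>(k, s). B (h + k) (c s))) = det (mat l l
        (\<lambda>(s, k). (-1) ^ c s * (-1) ^ (h + k) * column_entry a (\<iota> (c s)) (\<iota> (h + k))))"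
      by (simp add: det_transpose[of _ l])
    also have "\<dots> = (\<Prod>s<l. (-1) ^ c s * (-1) ^ (h + s)) * det D"
      unfolding D_def by (rule det_scale_rows_cols)
    also have "(\<Prod>s<l. (-1) ^ c s * (-1) ^ (h + s)) = ((-1) ^ (\<Sum>s<l. c s + h + s) :: real poly)"
      by (simp add: power_sum power_add mult.assoc)
    finally show ?thesis by (simp add: D)
  qed
  have "(-1) ^ (\<Sum>s<l. c s + h + s) * det (row_matrix a p) =
      (-1) ^ (\<Sum>s<l. c s + h + s) * det (column_matrix a p)"
    using minor row col by simp
  then show ?thesis by simp
qed

end
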